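(* Let $k\geq 1$ be an integer and let $G$ be an edge-colored complete graph on $n$ vertices satisfying $\Delta^{mon}(G)\leq n-2k$. If $G$ has a Gallai partition, then either $G$ contains $k$ pairwise vertex-disjoint properly colored cycles of length at most $4$, or each vertex of $G$ is contained in a properly colored cycle of length $3$ or $4$.
   Context: All graphs are finite and simple. An edge-colored graph is a graph with an arbitrary mapping $col:E(G)\to\mathbb{N}$ (not necessarily a proper coloring). For a color $i$, $G^i$ is the spanning subgraph of $G$ formed by the edges of color $i$, and $\Delta^{mon}(G)=\max_i \Delta(G^i)$ (maximum over the colors $i$ appearing in $G$) is the maximum monochromatic degree. A cycle is properly colored (PC) if any two adjacent edges of the cycle have distinct colors. For disjoint nonempty $S,T\subseteq V(G)$, $col(S,T)$ is the set of colors appearing on the edges between $S$ and $T$. A Gallai partition of an edge-colored complete graph $G$ is a partition of $V(G)$ into nonempty sets $U_1,\ldots,U_q$ with $q\geq 2$ such that $|col(U_i,U_j)|=1$ for all $1\leq i<j\leq q$ and $\left|\bigcup_{1\leq i<j\leq q} col(U_i,U_j)\right|\leq 2$. "Either ... or" is inclusive. *)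

theory Defs
  imports Main "HOL-Library.Disjoint_Sets" "HOL-Library.Ramsey"
begin

text \<open>
  A simple graph is given by a vertex set \<open>V\<close> and a set \<open>E\<close> of two-element subsets of \<open>V\<close>;
  an edge-coloring is a function on sets of vertices, of which only the values on \<open>E\<close> matter.
\<close>

definition simple_graph :: "'a set \<Rightarrow> 'a set set \<Rightarrow> bool" where
  "simple_graph V E \<longleftrightarrow> finite V \<and> V \<noteq> {} \<and> E \<subseteq> [V]\<^bsup>2\<^esup>"

definition complete_graph :: "'a set \<Rightarrow> 'a set set \<Rightarrow> bool" where
  "complete_graph V E \<longleftrightarrow> simple_graph V E \<and> clique V E"

definition degree :: "'a set set \<Rightarrow> 'a \<Rightarrow> nat" where
  "degree E v = card {e \<in> E. v \<in> e}"

definition max_degree :: "'a set \<Rightarrow> 'a set set \<Rightarrow> nat" where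
  "max_degree V E = Max (degree E ` V)"

definition color_class :: "'a set set \<Rightarrow> ('a set \<Rightarrow> nat) \<Rightarrow> nat \<Rightarrow> 'a set set" where
  "color_class E col i = {e \<in> E. col e = i}"

text \<open>The maximum is over the empty set, hence unspecified, if there are no edges.\<close>

definition max_mono_degree :: "'a set \<Rightarrow> 'a set set \<Rightarrow> ('a set \<Rightarrow> nat) \<Rightarrow> nat" where
  "max_mono_degree V E col = Max ((\<lambda>i. max_degree V (color_class E col i)) ` (col ` E))"

text \<open>
  A cycle is represented by the list of its vertices in cyclic order, without repeating
  the starting vertex; the length of the list is the length of the cycle.
\<close>

definition cycle_edges :: "'a list \<Rightarrow> 'a set set" where
  "cycle_edges c = {{c ! i, c ! (Suc i mod length c)} | i. i < length c}"

definition is_cycle :: "'a set \<Rightarrow> 'a set set \<Rightarrow> 'a list \<Rightarrow> bool" where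
  "is_cycle V E c \<longleftrightarrow>
     3 \<le> length c \<and> distinct c \<and> set c \<subseteq> V \<and> cycle_edges c \<subseteq> E"

definition pc_cycle :: "'a set \<Rightarrow> 'a set set \<Rightarrow> ('a set \<Rightarrow> nat) \<Rightarrow> 'a list \<Rightarrow> bool" where
  "pc_cycle V E col c \<longleftrightarrow>
     is_cycle V E c \<and>
     (\<forall>e\<in>cycle_edges c. \<forall>f\<in>cycle_edges c. e \<noteq> f \<and> e \<inter> f \<noteq> {} \<longrightarrow> col e \<noteq> col f)"

definition colors_between ::
    "'a set set \<Rightarrow> ('a set \<Rightarrow> nat) \<Rightarrow> 'a set \<Rightarrow> 'a set \<Rightarrow> nat set" where
  "colors_between E col S T = {col {s, t} | s t. s \<in> S \<and> t \<in> T \<and> {s, t} \<in> E}"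

text \<open>
  The parts form an unindexed set \<open>P\<close>. This loses nothing, as \<open>colors_between\<close> is symmetric
  in \<open>S\<close> and \<open>T\<close> and parts of a partition are nonempty and hence pairwise distinct.
\<close>

definition gallai_partition ::
    "'a set \<Rightarrow> 'a set set \<Rightarrow> ('a set \<Rightarrow> nat) \<Rightarrow> 'a set set \<Rightarrow> bool" where
  "gallai_partition V E col P \<longleftrightarrow>
     partition_on V P \<and> 2 \<le> card P \<and>
     (\<forall>S\<in>P. \<forall>T\<in>P. S \<noteq> T \<longrightarrow> card (colors_between E col S T) = 1) \<and>
     card (\<Union>S\<in>P. \<Union>T\<in>P - {S}. colors_between E col S T) \<le> 2"

end

theory Submission
  imports Defs
begin

text \<open>
  Suppose that \<open>v\<close> lies on no properly colored 4-cycle. Let \<open>U\<close> be the part of the Gallai partition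
  containing \<open>v\<close>, and let \<open>R\<close> and \<open>B\<close> be the sets of vertices outside \<open>U\<close> joined to \<open>U\<close> in red and
  in blue. If \<open>B\<close> is empty, then by the degree condition all vertices have at least \<open>2k - 1\<close>
  non-red neighbours on their own side of \<open>(U, R)\<close>; two disjoint non-red edges, one on each side,
  form a properly colored 4-cycle. If neither is empty, let \<open>z \<in> R\<close> have a non-red edge \<open>xz\<close> inside
  \<open>R\<close>. Then all edges from \<open>z\<close> to \<open>B\<close> are blue, since a red edge \<open>zy\<close> would give the cycle
  \<open>v x z y\<close>; symmetrically for \<open>B\<close>. Hence at most one of \<open>R\<close>, \<open>B\<close>
  contains such vertices, say only \<open>R\<close>. Deleting them from \<open>R\<close>, every remaining vertex of \<open>R\<close>
  has at least \<open>2k - 1\<close> blue neighbours in \<open>B\<close>, and every vertex of \<open>B\<close> at least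
  \<open>2k - 1\<close> red neighbours in the rest of \<open>R\<close>. This is a bipartite tournament of minimum out-degree at
  least \<open>2k - 1\<close>, and alternating 4-cycles are directed 4-cycles. In both cases a 4-cycle
  uses two vertices of each side, so cycles can be chosen greedily.
\<close>

section \<open>Greedy selection and alternating 4-cycles in bipartite relations\<close>

text \<open>Before the last choice at most \<open>k - 1\<close> lists exist, which block at most
  \<open>2 * k - 2\<close> vertices of \<open>X\<close> and as many of \<open>Y\<close>. The
  induction therefore carries these bounds on the union along with disjointness.\<close>

lemma disjoint_lists_greedy:
  fixes X Y :: "'a set" and Q :: "'a list \<Rightarrow> bool"
  assumes step: "\<And>W. \<lbrakk>finite W; card (W \<inter> X) < 2 * k - 1; card (W \<inter> Y) < 2 * k - 1\<rbrakk> \<Longrightarrow>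
      \<exists>c. Q c \<and> set c \<inter> W = {} \<and> card (set c \<inter> X) \<le> 2 \<and> card (set c \<inter> Y) \<le> 2"
  shows "\<exists>C :: nat \<Rightarrow> 'a list. (\<forall>i<k. Q (C i)) \<and> disjoint_family_on (\<lambda>i. set (C i)) {..<k}"
proof -
  have "\<exists>C :: nat \<Rightarrow> 'a list. (\<forall>i<m. Q (C i)) \<and> disjoint_family_on (\<lambda>i. set (C i)) {..<m} \<and>
      card ((\<Union>i<m. set (C i)) \<inter> X) \<le> 2 * m \<and> card ((\<Union>i<m. set (C i)) \<inter> Y) \<le> 2 * m"
    if "m \<le> k" for m
    using that
  proof (induction m)
    case 0
    then show ?case by (simp add: disjoint_family_on_def)
  next
    case (Suc m)
    then obtain C :: "nat \<Rightarrow> 'a list" where C: "\<forall>i<m. Q (C i)"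
        "disjoint_family_on (\<lambda>i. set (C i)) {..<m}"
        "card ((\<Union>i<m. set (C i)) \<inter> X) \<le> 2 * m" "card ((\<Union>i<m. set (C i)) \<inter> Y) \<le> 2 * m"
      by auto
    define W where "W = (\<Union>i<m. set (C i))"
    obtain c where c: "Q c" "set c \<inter> W = {}" "card (set c \<inter> X) \<le> 2" "card (set c \<inter> Y) \<le> 2"
    proof -
      have "finite W" "card (W \<inter> X) < 2 * k - 1" "card (W \<inter> Y) < 2 * k - 1"
        using C(3,4) Suc.prems by (simp_all add: W_def)
      from step[OF this] show ?thesis using that by blast
    qed
    define C' where "C' = C(m := c)"
    have union: "(\<Union>i<Suc m. set (C' i)) = set c \<union> W"
      by (auto simp: C'_def W_def lessThan_Suc)
    have "card ((set c \<union> W) \<inter> Z) \<le> 2 * Suc m"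
      if "card (set c \<inter> Z) \<le> 2" "card (W \<inter> Z) \<le> 2 * m" for Z
      using card_Un_le[of "set c \<inter> Z" "W \<inter> Z"] that by (simp add: Int_Un_distrib2)
    moreover have "disjoint_family_on (\<lambda>i. set (C' i)) {..<Suc m}"
    proof (unfold disjoint_family_on_def, intro ballI impI)
      fix i j assume ij: "i \<in> {..<Suc m}" "j \<in> {..<Suc m}" "i \<noteq> j"
      have "set c \<inter> set (C l) = {}" if "l < m" for l
        using c(2) that by (auto simp: W_def)
      moreover have "set (C i) \<inter> set (C j) = {}" if "i < m" "j < m"
        using C(2) that ij(3) by (simp add: disjoint_family_on_def)
      ultimately show "set (C' i) \<inter> set (C' j) = {}"
        using ij by (cases "i = m"; cases "j = m") (simp_all add: C'_def less_Suc_eq Int_commute)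
    qed
    moreover have "\<forall>i<Suc m. Q (C' i)"
      using C(1) c(1) by (auto simp: C'_def less_Suc_eq)
    ultimately show ?case
      using C(3,4) c(3,4) by (intro exI[of _ C']) (simp add: union, simp add: W_def)
  qed
  from this[of k] show ?thesis by blast
qed

text \<open>Choose \<open>x\<close> with inclusion-maximal neighbourhood, \<open>y'\<close> outside
  it and \<open>x'\<close> adjacent to \<open>y'\<close>. By maximality the neighbourhood of
  \<open>x'\<close>, which contains \<open>y'\<close>, cannot include that of \<open>x\<close>; any
  \<open>y\<close> in the difference closes the alternating cycle.\<close>

lemma bipartite_tournament_4cycle:
  assumes "finite X" "X \<noteq> {}"
    and non: "\<And>x. x \<in> X \<Longrightarrow> \<exists>y\<in>Y. \<not> A x y"
    and adj: "\<And>y. y \<in> Y \<Longrightarrow> \<exists>x\<in>X. A x y"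
  shows "\<exists>x\<in>X. \<exists>x'\<in>X. \<exists>y\<in>Y. \<exists>y'\<in>Y. A x y \<and> \<not> A x' y \<and> A x' y' \<and> \<not> A x y'"
proof -
  define N where "N x = {y \<in> Y. A x y}" for x
  have "finite (N ` X)" "N ` X \<noteq> {}"
    using assms by auto
  then obtain x where x: "x \<in> X" "\<And>x'. x' \<in> X \<Longrightarrow> N x \<subseteq> N x' \<Longrightarrow> N x' = N x"
    using finite_has_maximal[of "N ` X"] by auto
  obtain y' where y': "y' \<in> Y" "\<not> A x y'" using non x(1) by blast
  obtain x' where x': "x' \<in> X" "A x' y'" using adj y'(1) by blast
  have "\<not> N x \<subseteq> N x'"
    using x(2)[OF x'(1)] y' x' by (auto simp: N_def)
  then obtain y where "y \<in> Y" "A x y" "\<not> A x' y"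
    by (auto simp: N_def)
  with x(1) y' x' show ?thesis by blast
qed

lemma exists_outside:
  assumes "S \<subseteq> X" "card (W \<inter> X) < m" "m \<le> card S" "finite W"
  shows "\<exists>x\<in>S. x \<notin> W"
proof (rule ccontr)
  assume "\<not> ?thesis"
  then have "S \<subseteq> W \<inter> X" using assms(1) by blast
  then have "card S \<le> card (W \<inter> X)" using assms(4) by (intro card_mono) auto
  then show False using assms by linarith
qed

section \<open>Properly colored 4-cycles and color degrees in complete graphs\<close>

locale colored_complete_graph =
  fixes V :: "'a set" and E :: "'a set set" and col :: "'a set \<Rightarrow> nat"
  assumes complete: "complete_graph V E"
begin

lemma finite_V: "finite V"
  using complete by (simp add: complete_graph_def simple_graph_def)

lemma edge_iff: "{x, y} \<in> E \<longleftrightarrow> x \<in> V \<and> y \<in> V \<and> x \<noteq> y"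
  using complete
  by (auto simp: complete_graph_def simple_graph_def clique_def nsets_def doubleton_eq_iff subset_iff)

lemma edgeE:
  assumes "e \<in> E" "v \<in> e"
  obtains x where "e = {v, x}" "x \<in> V" "x \<noteq> v" "v \<in> V"
proof -
  have "e \<subseteq> V" "card e = 2"
    using complete assms(1) by (auto simp: complete_graph_def simple_graph_def nsets_def)
  then show ?thesis using that assms(2) by (auto simp: card_2_iff)
qed

lemma pc_4cycleI:
  assumes "a \<in> V" "b \<in> V" "c \<in> V" "d \<in> V" "distinct [a, b, c, d]"
    and "col {a, b} \<noteq> col {b, c}" "col {b, c} \<noteq> col {c, d}"
    and "col {c, d} \<noteq> col {d, a}" "col {d, a} \<noteq> col {a, b}"
  shows "pc_cycle V E col [a, b, c, d]"
proof -
  have "cycle_edges [a, b, c, d] = {{a, b}, {b, c}, {c, d}, {d, a}}"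
  proof -
    have "{i. i < length [a, b, c, d]} = {0, 1, 2, 3}" by auto
    moreover have "cycle_edges [a, b, c, d] =
        (\<lambda>i. {[a, b, c, d] ! i, [a, b, c, d] ! (Suc i mod 4)}) ` {i. i < length [a, b, c, d]}"
      by (auto simp: cycle_edges_def)
    ultimately show ?thesis by simp
  qed
  then show ?thesis
    using assms by (auto simp: pc_cycle_def is_cycle_def edge_iff)
qed

lemma degree_color_class:
  assumes "v \<in> V"
  shows "degree (color_class E col i) v = card {x \<in> V - {v}. col {v, x} = i}"
proof -
  have "{e \<in> color_class E col i. v \<in> e} = (\<lambda>x. {v, x}) ` {x \<in> V - {v}. col {v, x} = i}"
    using assms by (auto simp: color_class_def edge_iff elim!: edgeE)
  moreover have "inj_on (\<lambda>x. {v, x}) {x \<in> V - {v}. col {v, x} = i}"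
    by (auto simp: inj_on_def doubleton_eq_iff)
  ultimately show ?thesis by (simp add: degree_def card_image)
qed

text \<open>Of the \<open>card V - 1\<close> edges at \<open>v\<close>, at most
  \<open>card V - 2 * k\<close> have color \<open>i\<close>. The vertex \<open>w\<close> guarantees
  that \<open>i\<close> occurs on an edge, so that \<open>max_mono_degree\<close> takes it into
  account.\<close>

lemma card_other_colored_ge:
  assumes "int (max_mono_degree V E col) \<le> int (card V) - 2 * int k"
    and "v \<in> V" "w \<in> V" "v \<noteq> w" "col {v, w} = i"
  shows "2 * k - 1 \<le> card {x \<in> V - {v}. col {v, x} \<noteq> i}"
proof -
  have "E \<subseteq> Pow V"
    using complete by (auto simp: complete_graph_def simple_graph_def nsets_def)
  then have "finite E"
    using finite_V finite_subset by blast
  then have "max_degree V (color_class E col i) \<le> max_mono_degree V E col"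
    unfolding max_mono_degree_def using assms by (intro Max_ge) (auto simp: edge_iff)
  moreover have "degree (color_class E col i) v \<le> max_degree V (color_class E col i)"
    unfolding max_degree_def using finite_V assms by (intro Max_ge) auto
  ultimately have "int (card {x \<in> V - {v}. col {v, x} = i}) \<le> int (card V) - 2 * int k"
    using assms by (simp add: degree_color_class)
  moreover have "card V - 1 = card {x \<in> V - {v}. col {v, x} = i} + card {x \<in> V - {v}. col {v, x} \<noteq> i}"
  proof -
    have "V - {v} = {x \<in> V - {v}. col {v, x} = i} \<union> {x \<in> V - {v}. col {v, x} \<noteq> i}"
      by blast
    moreover have "card \<dots> = card {x \<in> V - {v}. col {v, x} = i} + card {x \<in> V - {v}. col {v, x} \<noteq> i}"
      using finite_V by (intro card_Un_disjoint) auto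
    ultimately show ?thesis using assms(2) by (metis card_Diff_singleton)
  qed
  ultimately show ?thesis by linarith
qed

section \<open>Disjoint cycles from the colors seen by one part\<close>

lemma disjoint_cycles_monochromatic_cut:
  assumes deg: "int (max_mono_degree V E col) \<le> int (card V) - 2 * int k"
    and V: "V = U \<union> R" "U \<inter> R = {}" "U \<noteq> {}" "R \<noteq> {}"
    and cut: "\<And>x y. x \<in> U \<Longrightarrow> y \<in> R \<Longrightarrow> col {x, y} = r"
  shows "\<exists>C :: nat \<Rightarrow> 'a list. (\<forall>i<k. pc_cycle V E col (C i) \<and> length (C i) \<le> 4) \<and>
            disjoint_family_on (\<lambda>i. set (C i)) {..<k}"
proof (rule disjoint_lists_greedy[where X = U and Y = R])
  fix W :: "'a set"
  assume W: "finite W" "card (W \<inter> U) < 2 * k - 1" "card (W \<inter> R) < 2 * k - 1"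
  \<comment> \<open>Non-\<open>r\<close> edges never cross the cut, so the many non-\<open>r\<close>
    neighbours of a vertex lie on its own side and cannot all be in \<open>W\<close>. Stated for a
    generic side \<open>S\<close>, to be used for both \<open>U\<close> and
    \<open>R\<close>.\<close>
  have pick: "\<exists>x\<in>S - W. \<exists>y\<in>S - W. x \<noteq> y \<and> col {x, y} \<noteq> r"
    if S: "card (W \<inter> S) < 2 * k - 1" "V = S \<union> T" "S \<inter> T = {}" "S \<noteq> {}" "T \<noteq> {}"
      and cut': "\<And>x y. x \<in> S \<Longrightarrow> y \<in> T \<Longrightarrow> col {x, y} = r" for S T
  proof -
    have nbrs: "2 * k - 1 \<le> card {y \<in> V - {x}. col {x, y} \<noteq> r}"
      and sub: "{y \<in> V - {x}. col {x, y} \<noteq> r} \<subseteq> S" if "x \<in> S" for x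
    proof -
      obtain t where "t \<in> T" using S(5) by blast
      then show "2 * k - 1 \<le> card {y \<in> V - {x}. col {x, y} \<noteq> r}"
        using card_other_colored_ge[OF deg, of x t r] cut'[of x t] S that by auto
      show "{y \<in> V - {x}. col {x, y} \<noteq> r} \<subseteq> S" using cut' S that by auto
    qed
    \<comment> \<open>The vertex \<open>x0\<close> may lie in \<open>W\<close>; its neighbours only
      show that \<open>S\<close> is too large to be covered by \<open>W\<close>. The edge sought
      starts at \<open>x\<close>.\<close>
    obtain x0 where x0: "x0 \<in> S" using S(4) by blast
    obtain x where x: "x \<in> S" "x \<notin> W"
      using exists_outside[OF sub[OF x0] S(1) nbrs[OF x0] W(1)] sub[OF x0] by (meson subsetD)
    obtain y where y: "y \<in> {y \<in> V - {x}. col {x, y} \<noteq> r}" "y \<notin> W"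
      using exists_outside[OF sub[OF x(1)] S(1) nbrs[OF x(1)] W(1)] by (rule bexE)
    moreover have "y \<in> S" using sub[OF x(1)] y(1) by (rule subsetD)
    ultimately show ?thesis using x by (intro bexI[of _ x] bexI[of _ y]) auto
  qed
  obtain u u' where u: "u \<in> U - W" "u' \<in> U - W" "u \<noteq> u'" "col {u, u'} \<noteq> r"
    using pick[OF W(2) V cut] by blast
  have "V = R \<union> U" "R \<inter> U = {}"
    using V by auto
  moreover have "col {x, y} = r" if "x \<in> R" "y \<in> U" for x y
    using cut[OF that(2,1)] by (simp add: insert_commute)
  ultimately obtain w w' where w: "w \<in> R - W" "w' \<in> R - W" "w \<noteq> w'" "col {w, w'} \<noteq> r"
    using pick[OF W(3), of U] V by blast
  have red: "col {u', w} = r" "col {w', u} = r"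
    using u w cut[of u' w] cut[of u w'] by (auto simp: insert_commute)
  have "pc_cycle V E col [u, u', w, w']"
    using u w red V by (intro pc_4cycleI) auto
  moreover have "set [u, u', w, w'] \<inter> U = {u, u'}" "set [u, u', w, w'] \<inter> R = {w, w'}"
    using u w V by auto
  ultimately show "\<exists>c. (pc_cycle V E col c \<and> length c \<le> 4) \<and> set c \<inter> W = {} \<and>
      card (set c \<inter> U) \<le> 2 \<and> card (set c \<inter> R) \<le> 2"
    using u w by (intro exI[of _ "[u, u', w, w']"]) auto
qed

text \<open>Orient edges of color \<open>b\<close> from \<open>X\<close> to \<open>Y\<close> and
  edges of color \<open>r\<close> from \<open>Y\<close> to \<open>X\<close>. Removing fewer than
  \<open>2 * k - 1\<close> vertices from each side leaves every out-degree positive, so an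
  alternating 4-cycle survives.\<close>

lemma disjoint_cycles_bipartite:
  assumes "r \<noteq> b"
    and XY: "X \<subseteq> V" "Y \<subseteq> V" "X \<inter> Y = {}" "Y \<noteq> {}"
    and X: "\<And>x. x \<in> X \<Longrightarrow> 2 * k - 1 \<le> card {y \<in> Y. col {x, y} = b}"
    and Y: "\<And>y. y \<in> Y \<Longrightarrow> 2 * k - 1 \<le> card {x \<in> X. col {x, y} = r}"
    and two: "\<And>x y. x \<in> X \<Longrightarrow> y \<in> Y \<Longrightarrow> col {x, y} \<in> {r, b}"
  shows "\<exists>C :: nat \<Rightarrow> 'a list. (\<forall>i<k. pc_cycle V E col (C i) \<and> length (C i) \<le> 4) \<and>
            disjoint_family_on (\<lambda>i. set (C i)) {..<k}"
proof (rule disjoint_lists_greedy[where X = X and Y = Y])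
  fix W :: "'a set"
  assume W: "finite W" "card (W \<inter> X) < 2 * k - 1" "card (W \<inter> Y) < 2 * k - 1"
  have "finite X"
    using XY finite_V finite_subset by blast
  have X': "\<exists>y\<in>Y - W. \<not> col {x, y} = r" if "x \<in> X" for x
    using exists_outside[OF _ W(3) X[OF that] W(1)] \<open>r \<noteq> b\<close> by auto
  have Y': "\<exists>x\<in>X - W. col {x, y} = r" if "y \<in> Y" for y
    using exists_outside[OF _ W(2) Y[OF that] W(1)] by auto
  \<comment> \<open>\<open>Y'\<close> holds for every vertex of \<open>Y\<close>, including those in
    \<open>W\<close>.\<close>
  have "X - W \<noteq> {}" using Y' XY(4) by blast
  then obtain x x' y y' where *: "x \<in> X - W" "x' \<in> X - W" "y \<in> Y - W" "y' \<in> Y - W"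
      "col {x, y} = r" "col {x', y} \<noteq> r" "col {x', y'} = r" "col {x, y'} \<noteq> r"
    using bipartite_tournament_4cycle[of "X - W" "Y - W" "\<lambda>x y. col {x, y} = r"] \<open>finite X\<close> X' Y' by blast
  have "pc_cycle V E col [x, y, x', y']"
    using * XY by (intro pc_4cycleI) (auto simp: insert_commute)
  moreover have "set [x, y, x', y'] \<inter> X = {x, x'}" "set [x, y, x', y'] \<inter> Y = {y, y'}"
    using * XY by auto
  moreover have "card {x, x'} \<le> 2" "card {y, y'} \<le> 2"
    by (simp_all add: card_insert_if)
  ultimately show "\<exists>c. (pc_cycle V E col c \<and> length c \<le> 4) \<and> set c \<inter> W = {} \<and>
      card (set c \<inter> X) \<le> 2 \<and> card (set c \<inter> Y) \<le> 2"
    using * by (intro exI[of _ "[x, y, x', y']"]) auto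
qed

text \<open>With \<open>X\<close> the vertices of \<open>R\<close> whose edges inside
  \<open>R\<close> all have color \<open>r\<close>, non-\<open>r\<close> edges at \<open>X\<close>
  lead only to \<open>B\<close>, and non-\<open>b\<close> edges at \<open>B\<close> only to
  \<open>X\<close>. The degree bound thus becomes the out-degree bound of the bipartite case for
  \<open>X\<close> and \<open>B\<close>.\<close>

lemma disjoint_cycles_one_side_monochromatic:
  assumes deg: "int (max_mono_degree V E col) \<le> int (card V) - 2 * int k" and "r \<noteq> b"
    and V: "V = U \<union> R \<union> B" "U \<inter> R = {}" "U \<inter> B = {}" "R \<inter> B = {}" "v \<in> U" "B \<noteq> {}"
    and UR: "\<And>x y. x \<in> U \<Longrightarrow> y \<in> R \<Longrightarrow> col {x, y} = r"
    and UB: "\<And>x y. x \<in> U \<Longrightarrow> y \<in> B \<Longrightarrow> col {x, y} = b"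
    and RB: "\<And>x y. x \<in> R \<Longrightarrow> y \<in> B \<Longrightarrow> col {x, y} \<in> {r, b}"
    and R': "\<And>x z y. \<lbrakk>x \<in> R; z \<in> R; x \<noteq> z; col {x, z} \<noteq> r; y \<in> B\<rbrakk> \<Longrightarrow> col {z, y} = b"
    and B: "\<And>x y. \<lbrakk>x \<in> B; y \<in> B; x \<noteq> y\<rbrakk> \<Longrightarrow> col {x, y} = b"
  shows "\<exists>C :: nat \<Rightarrow> 'a list. (\<forall>i<k. pc_cycle V E col (C i) \<and> length (C i) \<le> 4) \<and>
            disjoint_family_on (\<lambda>i. set (C i)) {..<k}"
proof -
  define X where "X = {z \<in> R. \<forall>x\<in>R. x \<noteq> z \<longrightarrow> col {z, x} = r}"
  show ?thesis
  proof (rule disjoint_cycles_bipartite[OF \<open>r \<noteq> b\<close>])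
    show "X \<subseteq> V" "B \<subseteq> V" "X \<inter> B = {}" "B \<noteq> {}"
      using V by (auto simp: X_def)
    show "col {x, y} \<in> {r, b}" if "x \<in> X" "y \<in> B" for x y
      using RB that by (auto simp: X_def)
    fix x assume x: "x \<in> X"
    then have "col {x, v} = r"
      using UR[of v x] V(5) by (auto simp: X_def insert_commute)
    then have "2 * k - 1 \<le> card {y \<in> V - {x}. col {x, y} \<noteq> r}"
      using card_other_colored_ge[OF deg, of x v r] x V by (auto simp: X_def)
    moreover have "{y \<in> V - {x}. col {x, y} \<noteq> r} = {y \<in> B. col {x, y} = b}"
    proof (intro equalityI subsetI)
      fix y assume "y \<in> {y \<in> V - {x}. col {x, y} \<noteq> r}"
      then have y: "y \<in> V" "y \<noteq> x" "col {x, y} \<noteq> r" by auto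
      moreover from this have "y \<notin> U" using UR[of y x] x by (auto simp: X_def insert_commute)
      ultimately have "y \<in> B" using V x by (auto simp: X_def)
      then show "y \<in> {y \<in> B. col {x, y} = b}" using RB[of x y] x y by (auto simp: X_def)
    next
      fix y assume "y \<in> {y \<in> B. col {x, y} = b}"
      then show "y \<in> {y \<in> V - {x}. col {x, y} \<noteq> r}" using x V \<open>r \<noteq> b\<close> by (auto simp: X_def)
    qed
    ultimately show "2 * k - 1 \<le> card {y \<in> B. col {x, y} = b}" by simp
  next
    fix y assume y: "y \<in> B"
    then have "col {y, v} = b"
      using UB[of v y] V(5) by (simp add: insert_commute)
    then have "2 * k - 1 \<le> card {x \<in> V - {y}. col {y, x} \<noteq> b}"
      using card_other_colored_ge[OF deg, of y v b] y V by auto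
    \<comment> \<open>\<open>UB\<close> excludes \<open>x\<close> from \<open>U\<close>,
      \<open>B\<close> excludes it from the block \<open>B\<close>, and the contrapositive of
      \<open>R'\<close> excludes it from \<open>R - X\<close>.\<close>
    moreover have "{x \<in> V - {y}. col {y, x} \<noteq> b} = {x \<in> X. col {x, y} = r}"
    proof (intro equalityI subsetI)
      fix x assume "x \<in> {x \<in> V - {y}. col {y, x} \<noteq> b}"
      then have x: "x \<in> V" "x \<noteq> y" "col {x, y} \<noteq> b" by (auto simp: insert_commute)
      then have "x \<in> R" using V UB B y by auto
      moreover from this have "col {x, y} = r" using RB x y by auto
      moreover have "col {x, z} = r" if "z \<in> R" "z \<noteq> x" for z
        using R'[of z x y] that x y \<open>x \<in> R\<close> by (auto simp: insert_commute)
      ultimately show "x \<in> {x \<in> X. col {x, y} = r}" by (auto simp: X_def)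
    next
      fix x assume "x \<in> {x \<in> X. col {x, y} = r}"
      then show "x \<in> {x \<in> V - {y}. col {y, x} \<noteq> b}"
        using y V \<open>r \<noteq> b\<close> by (auto simp: X_def insert_commute)
    qed
    ultimately show "2 * k - 1 \<le> card {x \<in> X. col {x, y} = r}" by simp
  qed
qed

lemma disjoint_cycles_tripartition:
  assumes deg: "int (max_mono_degree V E col) \<le> int (card V) - 2 * int k" and "r \<noteq> b"
    and V: "V = U \<union> R \<union> B" "U \<inter> R = {}" "U \<inter> B = {}" "R \<inter> B = {}" "v \<in> U" "R \<noteq> {}" "B \<noteq> {}"
    and UR: "\<And>x y. x \<in> U \<Longrightarrow> y \<in> R \<Longrightarrow> col {x, y} = r"
    and UB: "\<And>x y. x \<in> U \<Longrightarrow> y \<in> B \<Longrightarrow> col {x, y} = b"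
    and RB: "\<And>x y. x \<in> R \<Longrightarrow> y \<in> B \<Longrightarrow> col {x, y} \<in> {r, b}"
    and v: "\<And>x y z. \<not> pc_cycle V E col [v, x, y, z]"
  shows "\<exists>C :: nat \<Rightarrow> 'a list. (\<forall>i<k. pc_cycle V E col (C i) \<and> length (C i) \<le> 4) \<and>
            disjoint_family_on (\<lambda>i. set (C i)) {..<k}"
proof -
  \<comment> \<open>Otherwise the colors along \<open>v, x, z, y\<close> would be \<open>r\<close>,
    some color other than \<open>r\<close>, \<open>r\<close>, and \<open>b\<close> on the closing
    edge.\<close>
  have R': "col {z, y} = b" if h: "x \<in> R" "z \<in> R" "x \<noteq> z" "col {x, z} \<noteq> r" "y \<in> B" for x z y
  proof (rule ccontr)
    assume "col {z, y} \<noteq> b"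
    then have "pc_cycle V E col [v, x, z, y]"
      using h V RB[of z y] UR[of v x] UB[of v y] \<open>r \<noteq> b\<close>
      by (intro pc_4cycleI) (auto simp: insert_commute)
    then show False using v by blast
  qed
  have B': "col {z, y} = r" if h: "x \<in> B" "z \<in> B" "x \<noteq> z" "col {x, z} \<noteq> b" "y \<in> R" for x z y
  proof (rule ccontr)
    assume "col {z, y} \<noteq> r"
    then have "pc_cycle V E col [v, x, z, y]"
      using h V RB[of y z] UR[of v y] UB[of v x] \<open>r \<noteq> b\<close>
      by (intro pc_4cycleI) (auto simp: insert_commute)
    then show False using v by blast
  qed
  show ?thesis
  proof (cases "\<forall>x\<in>B. \<forall>y\<in>B. x \<noteq> y \<longrightarrow> col {x, y} = b")
    case True
    show ?thesis
      by (rule disjoint_cycles_one_side_monochromatic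
          [OF deg \<open>r \<noteq> b\<close> V(1-5) V(7) UR UB RB R']) (use True in auto)
  next
    case False
    then obtain y y' where y: "y \<in> B" "y' \<in> B" "y \<noteq> y'" "col {y, y'} \<noteq> b" by blast
    \<comment> \<open>If not, \<open>R'\<close> forces color \<open>b\<close> on the edge from
      \<open>x'\<close> to \<open>y'\<close>, while \<open>B'\<close> forces \<open>r\<close>. So
      \<open>R\<close> is monochromatic inside, and the previous lemma applies with the roles of
      \<open>R\<close>, \<open>r\<close> and \<open>B\<close>, \<open>b\<close> exchanged.\<close>
    have "col {x, x'} = r" if "x \<in> R" "x' \<in> R" "x \<noteq> x'" for x x'
      using R'[of x x' y'] B'[of y y' x'] that y \<open>r \<noteq> b\<close> by (auto simp: insert_commute)
    moreover have "V = U \<union> B \<union> R" "B \<inter> R = {}" "b \<noteq> r"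
      using V \<open>r \<noteq> b\<close> by auto
    moreover have "col {x, y} \<in> {b, r}" if "x \<in> B" "y \<in> R" for x y
      using RB[OF that(2,1)] by (simp add: insert_commute disj_commute)
    ultimately show ?thesis
      using disjoint_cycles_one_side_monochromatic[OF deg, of b r U B R v] V UR UB B'
      by blast
  qed
qed

section \<open>From a Gallai partition to three blocks\<close>

text \<open>Keep the part \<open>U\<close> of \<open>v\<close> and merge the other parts according
  to their color towards \<open>U\<close>. Edges inside a merged block may have any color, but edges
  between the two blocks join different parts.\<close>

lemma gallai_tripartition:
  assumes P: "gallai_partition V E col P" and "v \<in> V"
  obtains U R B r b where "r \<noteq> b" "V = U \<union> R \<union> B" "U \<inter> R = {}" "U \<inter> B = {}" "R \<inter> B = {}"
    "v \<in> U" "R \<union> B \<noteq> {}"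
    "\<And>x y. x \<in> U \<Longrightarrow> y \<in> R \<Longrightarrow> col {x, y} = r"
    "\<And>x y. x \<in> U \<Longrightarrow> y \<in> B \<Longrightarrow> col {x, y} = b"
    "\<And>x y. x \<in> R \<Longrightarrow> y \<in> B \<Longrightarrow> col {x, y} \<in> {r, b}"
proof -
  have part: "partition_on V P" and "2 \<le> card P"
    and one: "\<And>S T. \<lbrakk>S \<in> P; T \<in> P; S \<noteq> T\<rbrakk> \<Longrightarrow> card (colors_between E col S T) = 1"
    using P by (auto simp: gallai_partition_def)
  define D where "D = (\<Union>S\<in>P. \<Union>T\<in>P - {S}. colors_between E col S T)"
  have "card D \<le> 2"
    using P by (simp add: gallai_partition_def D_def)
  \<comment> \<open>An infinite set has \<open>card\<close> 0, so \<open>card D \<le> 2\<close> does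
    not yet bound \<open>D\<close>; finiteness comes from \<open>card\<close> being 1 for each pair
    of parts.\<close>
  moreover have "finite D"
  proof -
    have "finite (colors_between E col S T)" if "S \<in> P" "T \<in> P - {S}" for S T
      using that one[of S T] by (metis DiffD1 DiffD2 card_ge_0_finite singletonI zero_less_one)
    then show ?thesis
      unfolding D_def using finite_elements[OF finite_V part] by blast
  qed
  ultimately obtain r b where rb: "r \<noteq> b" "D \<subseteq> {r, b}"
  proof -
    \<comment> \<open>\<open>D\<close> may contain a single color; the colors 0 and 1 pad it to a
      set of exactly two, so that \<open>r\<close> and \<open>b\<close> are always distinct.\<close>
    have fin: "finite (D \<union> {0, 1})" using \<open>finite D\<close> by simp
    then have "card {0::nat, 1} \<le> card (D \<union> {0, 1})" by (intro card_mono) auto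
    then have "2 \<le> card (D \<union> {0, 1})" by simp
    then obtain F where "D \<subseteq> F" "card F = 2"
      using exists_subset_between[OF \<open>card D \<le> 2\<close> _ Un_upper1 fin] by blast
    then show ?thesis using that by (auto simp: card_2_iff)
  qed
  have disj: "S = T" if "S \<in> P" "T \<in> P" "x \<in> S" "x \<in> T" for S T x
    using that part by (auto simp: partition_on_def disjoint_def)
  have cross: "col {x, y} \<in> colors_between E col S T"
    if "S \<in> P" "T \<in> P" "S \<noteq> T" "x \<in> S" "y \<in> T" for S T x y
  proof -
    have "{x, y} \<in> E"
      using that disj partition_onD1[OF part] by (auto simp: edge_iff)
    then show ?thesis using that by (auto simp: colors_between_def)
  qed
  have same: "col {x, y} = col {x', y'}"
    if "S \<in> P" "T \<in> P" "S \<noteq> T" "x \<in> S" "y \<in> T" "x' \<in> S" "y' \<in> T" for S T x y x' y'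
    using cross[OF that(1-5)] cross[OF that(1-3,6,7)] one[OF that(1-3)]
    by (auto simp: card_1_singleton_iff)
  have inD: "col {x, y} \<in> {r, b}" if "S \<in> P" "T \<in> P" "S \<noteq> T" "x \<in> S" "y \<in> T" for S T x y
    using cross[OF that] that rb(2) unfolding D_def by blast
  have ex: "\<exists>T\<in>P. x \<in> T" if "x \<in> V" for x
    using that partition_onD1[OF part] by blast
  obtain U where U: "U \<in> P" "v \<in> U" using ex \<open>v \<in> V\<close> by blast
  have UV: "U \<subseteq> V" using U partition_onD1[OF part] by blast
  define R where "R = {x \<in> V - U. col {v, x} = r}"
  define B where "B = {x \<in> V - U. col {v, x} = b}"
  have out: "\<exists>T\<in>P. T \<noteq> U \<and> x \<in> T" if "x \<in> V - U" for x
    using that ex by blast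
  show ?thesis
  proof (rule that[of r b U R B])
    have "x \<in> R \<union> B" if x: "x \<in> V - U" for x
      using out[OF x] inD[OF U(1) _ _ U(2)] x by (auto simp: R_def B_def)
    then show V: "V = U \<union> R \<union> B" using UV by (auto simp: R_def B_def)
    have "P \<noteq> {U}" using \<open>2 \<le> card P\<close> by auto
    then obtain T where T: "T \<in> P" "T \<noteq> U" using U(1) by blast
    then obtain x where "x \<in> T" using partition_onD3[OF part] by (metis all_not_in_conv)
    then have "x \<in> V - U" using disj[of T U x] T U partition_onD1[OF part] by blast
    then show "R \<union> B \<noteq> {}" using V by blast
    show "U \<inter> R = {}" "U \<inter> B = {}" "R \<inter> B = {}"
      using rb(1) by (auto simp: R_def B_def)
    show "col {x, y} = r" if "x \<in> U" "y \<in> R" for x y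
    proof -
      obtain T where "T \<in> P" "T \<noteq> U" "y \<in> T" using out \<open>y \<in> R\<close> by (auto simp: R_def)
      then show ?thesis using same[of U T x y v y] U that by (auto simp: R_def)
    qed
    show "col {x, y} = b" if "x \<in> U" "y \<in> B" for x y
    proof -
      obtain T where "T \<in> P" "T \<noteq> U" "y \<in> T" using out \<open>y \<in> B\<close> by (auto simp: B_def)
      then show ?thesis using same[of U T x y v y] U that by (auto simp: B_def)
    qed
    show "col {x, y} \<in> {r, b}" if "x \<in> R" "y \<in> B" for x y
    proof -
      obtain S T where S: "S \<in> P" "S \<noteq> U" "x \<in> S" and T: "T \<in> P" "T \<noteq> U" "y \<in> T"
        using out[of x] out[of y] \<open>x \<in> R\<close> \<open>y \<in> B\<close> unfolding R_def B_def by blast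
      \<comment> \<open>Two vertices of the same part have the same color towards \<open>v\<close>,
        whereas \<open>x\<close> and \<open>y\<close> have \<open>r\<close> and
        \<open>b\<close>.\<close>
      have "S \<noteq> T"
        using same[of U S v x v y] S T U that rb(1) by (auto simp: R_def B_def)
      then show ?thesis using inD S T by blast
    qed
  qed (use rb U in auto)
qed

end

theorem theorem8:
  fixes V :: "'a set" and E :: "'a set set" and col :: "'a set \<Rightarrow> nat" and n k :: nat
  assumes "1 \<le> k"
    and "complete_graph V E" and "card V = n"
    and "int (max_mono_degree V E col) \<le> int n - 2 * int k"
    and "\<exists>P. gallai_partition V E col P"
  shows "(\<exists>C :: nat \<Rightarrow> 'a list.
            (\<forall>i<k. pc_cycle V E col (C i) \<and> length (C i) \<le> 4) \<and>
            disjoint_family_on (\<lambda>i. set (C i)) {..<k}) \<or>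
         (\<forall>v\<in>V. \<exists>c. pc_cycle V E col c \<and> length c \<in> {3, 4} \<and> v \<in> set c)"
proof -
  interpret colored_complete_graph V E col by unfold_locales (fact assms)
  have deg: "int (max_mono_degree V E col) \<le> int (card V) - 2 * int k"
    using assms by simp
  have "\<exists>C :: nat \<Rightarrow> 'a list. (\<forall>i<k. pc_cycle V E col (C i) \<and> length (C i) \<le> 4) \<and>
            disjoint_family_on (\<lambda>i. set (C i)) {..<k}"
    if v: "v \<in> V" "\<not> (\<exists>c. pc_cycle V E col c \<and> length c \<in> {3, 4} \<and> v \<in> set c)" for v
  proof -
    obtain P where "gallai_partition V E col P" using assms by blast
    then obtain U R B r b where *: "r \<noteq> b" "V = U \<union> R \<union> B" "U \<inter> R = {}" "U \<inter> B = {}" "R \<inter> B = {}"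
      "v \<in> U" "R \<union> B \<noteq> {}"
      "\<And>x y. x \<in> U \<Longrightarrow> y \<in> R \<Longrightarrow> col {x, y} = r"
      "\<And>x y. x \<in> U \<Longrightarrow> y \<in> B \<Longrightarrow> col {x, y} = b"
      "\<And>x y. x \<in> R \<Longrightarrow> y \<in> B \<Longrightarrow> col {x, y} \<in> {r, b}"
      by (rule gallai_tripartition[OF _ v(1)]) (rule that)
    have no_cycle: "\<not> pc_cycle V E col [v, x, y, z]" for x y z
      using v(2) by force
    \<comment> \<open>Since \<open>R \<union> B\<close> is nonempty, an empty block leaves the other
      nonempty, and \<open>U\<close> together with it forms a monochromatic cut.\<close>
    consider "B = {}" | "R = {}" | "R \<noteq> {}" "B \<noteq> {}" by blast
    then show ?thesis
    proof cases
      case 1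
      then show ?thesis
        using * by (intro disjoint_cycles_monochromatic_cut[OF deg, of U R r]) auto
    next
      case 2
      then show ?thesis
        using * by (intro disjoint_cycles_monochromatic_cut[OF deg, of U B b]) auto
    next
      case 3
      show ?thesis
        by (rule disjoint_cycles_tripartition
            [OF deg *(1-6) 3 *(8-10) no_cycle])
    qed
  qed
  then show ?thesis by blast
qed

end
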